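(* A semi-regular SBBD is A-optimum relative to $\Omega$. That is, if $X\in\Omega=\Omega(v_1,v_2,N,k_1,k_2,\mu)$ is the design matrix of a semi-regular SBBD, then $X$ minimizes $\sum_{i=1}^{(v_1-1)(v_2-1)}\frac{1}{\alpha_i(X')}$ among all $X'\in\Omega$.
   Context: Let $v_1,v_2,N$ be positive integers, $V_1,V_2$ disjoint sets with $|V_1|=v_1$, $|V_2|=v_2$ (identified with $\{1,\dots,v_1\}$ and $\{1,\dots,v_2\}$), and $K_{v_1,v_2}=(V_1,V_2;E)$ the complete bipartite graph with edges $e_{ij}$ ($i\in V_1,j\in V_2$). Subgraphs are identified with their edge sets. The design matrix of a collection $\mathcal{B}=\{B_1,\dots,B_N\}$ of subgraphs (repetitions allowed) is the $N\times v_1v_2$ $(0,1)$-matrix $X$ with columns indexed by the edges in the lexicographical order $(e_{11},\dots,e_{1v_2};\dots;e_{v_11},\dots,e_{v_1v_2})$, with entry $1$ in row $k$ and the column of $e_{ij}$ if $e_{ij}\in B_k$ and $0$ otherwise. A subgraph of $K_{v_1,v_2}$ is a semi-regular bipartite subgraph with degrees $k_1,k_2$ if every point of $V_1$ has degree $k_1$ and every point of $V_2$ has degree $k_2$ (so $v_1k_1=v_2k_2$). The class $\Omega=\Omega(v_1,v_2,N,k_1,k_2,\mu)$, where $N\ge(v_1-1)(v_2-1)$ and $v_1k_1=v_2k_2$, is the set of $N\times v_1v_2$ matrices $X$ such that: (C1) each column of $X$ contains exactly $\mu$ ones; (C2) $X$ is the design matrix of a collection of $N$ semi-regular bipartite subgraphs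 of $K_{v_1,v_2}$ with degrees $k_1,k_2$; (C3) all elementary contrasts $(e_{ij}^{(v_1)}\otimes e_{i'j'}^{(v_2)})^t\boldsymbol{\tau}$, $1\le i<j\le v_1$, $1\le i'<j'\le v_2$, are estimable. Here $e_{ij}^{(v)}\in\mathbb{R}^v$ has $i$-th entry $1$, $j$-th entry $-1$ and all other entries $0$. Estimability refers to the model $\mathbf{y}=X\boldsymbol{\tau}+\boldsymbol{\epsilon}$ with $\boldsymbol{\tau}=(\tau_{ij})$ in the same lexicographical order, subject to $\sum_j\tau_{ij}=0$ for all $i$ and $\sum_i\tau_{ij}=0$ for all $j$, and independent $N(0,\sigma^2)$ errors: $\mathbf{c}^t\boldsymbol{\tau}$ is estimable if there is a vector $\mathbf{a}$ such that the expectation of $\mathbf{a}^t\mathbf{y}$ equals $\mathbf{c}^t\boldsymbol{\tau}$ for all admissible $\boldsymbol{\tau}$. A semi-regular SBBD is a design whose design matrix $X$ lies in $\Omega$ and whose collection $\mathcal{B}$ of blocks satisfies, for some integers $\lambda_{12},\lambda_{21},\lambda_{22}$: (i) every $B_k$ is incident with all points of $V_1$ and $V_2$; (ii) each edge belongs to exactly $\mu$ of the $B_k$; (iii) any two edges $e_{ij},e_{ij'}$, $j\ne j'$, lie together in exactly $\lambda_{12}$ of the $B_k$; (iv) any two edges $e_{ij},e_{i'j}$, $i\neq i'$, lie together in exactly $\lambda_{21}$ of the $B_k$; (v) any two edges $e_{ij},e_{i'j'}$, $i\ne i'$, $j\neq j'$, lie together in exactly $\lambda_{22}$ of the $B_k$.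 For every $X\in\Omega$, the all-ones vector $\boldsymbol{1}_{v_1v_2}$ and all vectors $\mathbf{z}\otimes\boldsymbol{1}_{v_2}$ ($\mathbf{z}\perp\boldsymbol{1}_{v_1}$) and $\boldsymbol{1}_{v_1}\otimes\mathbf{w}$ ($\mathbf{w}\perp\boldsymbol{1}_{v_2}$) are eigenvectors of $X^tX$. Let $\boldsymbol{u}_1,\dots,\boldsymbol{u}_{(v_1-1)(v_2-1)}$ be orthonormal eigenvectors of $X^tX$ orthogonal to all of these vectors, and let $\alpha_i(X)$ be the eigenvalue of $X^tX$ for $\boldsymbol{u}_i$; by (C3) these eigenvalues are positive. $X\in\Omega$ is A-optimum relative to $\Omega$ if $\sum_{i}1/\alpha_i(X)$ is minimum among all members of $\Omega$. *)

theory Defs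
  imports "HOL-Probability.Distributions" "Jordan_Normal_Form.Char_Poly"
begin

unbundle no inner_syntax
unbundle no vec_syntax

text \<open>
  The points of \<open>V\<^sub>1\<close> and \<open>V\<^sub>2\<close> are numbered from \<open>0\<close>, so the edge joining \<open>i < v1\<close> to \<open>j < v2\<close> is the
  pair \<open>(i, j)\<close> and has position \<open>i * v2 + j\<close> in the lexicographical order. A collection of \<open>N\<close>
  subgraphs (repetitions allowed) is a function \<open>B\<close> of which only the values \<open>B k\<close> with \<open>k < N\<close> matter.
\<close>

definition edges :: "nat \<Rightarrow> nat \<Rightarrow> (nat \<times> nat) set" where
  "edges v1 v2 = {..<v1} \<times> {..<v2}"

definition design_matrix :: "nat \<Rightarrow> nat \<Rightarrow> nat \<Rightarrow> (nat \<Rightarrow> (nat \<times> nat) set) \<Rightarrow> real mat" where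
  "design_matrix v1 v2 N B =
     mat N (v1 * v2) (\<lambda>(k, c). if (c div v2, c mod v2) \<in> B k then 1 else 0)"

definition semi_regular :: "nat \<Rightarrow> nat \<Rightarrow> nat \<Rightarrow> nat \<Rightarrow> (nat \<times> nat) set \<Rightarrow> bool" where
  "semi_regular v1 v2 k1 k2 H \<longleftrightarrow>
     H \<subseteq> edges v1 v2 \<and>
     (\<forall>i<v1. card {j. (i, j) \<in> H} = k1) \<and>
     (\<forall>j<v2. card {i. (i, j) \<in> H} = k2)"

definition kron_vec :: "real vec \<Rightarrow> real vec \<Rightarrow> real vec" where
  "kron_vec x y = vec (dim_vec x * dim_vec y) (\<lambda>c. x $ (c div dim_vec y) * y $ (c mod dim_vec y))"

definition ones :: "nat \<Rightarrow> real vec" where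
  "ones n = vec n (\<lambda>_. 1)"

definition contrast_vec :: "nat \<Rightarrow> nat \<Rightarrow> nat \<Rightarrow> real vec" where
  "contrast_vec v i j = vec v (\<lambda>l. if l = i then 1 else if l = j then -1 else 0)"

definition admissible :: "nat \<Rightarrow> nat \<Rightarrow> real vec set" where
  "admissible v1 v2 = {\<tau> \<in> carrier_vec (v1 * v2).
     (\<forall>i<v1. (\<Sum>j<v2. \<tau> $ (i * v2 + j)) = 0) \<and>
     (\<forall>j<v2. (\<Sum>i<v1. \<tau> $ (i * v2 + j)) = 0)}"

definition error_distribution :: "nat \<Rightarrow> real \<Rightarrow> (nat \<Rightarrow> real) measure" where
  "error_distribution N \<sigma> =
     (\<Pi>\<^sub>M k\<in>{..<N}. density lborel (\<lambda>x. ennreal (normal_density 0 \<sigma> x)))"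

text \<open>
  \<open>normal_density\<close> takes the standard deviation. Since the error variance is an unknown parameter of
  the model, the unbiasedness condition ranges over all \<open>\<sigma> > 0\<close>.
\<close>

definition estimable :: "nat \<Rightarrow> nat \<Rightarrow> real mat \<Rightarrow> real vec \<Rightarrow> bool" where
  "estimable v1 v2 X c \<longleftrightarrow>
     (\<exists>a \<in> carrier_vec (dim_row X). \<forall>\<sigma>>0. \<forall>\<tau> \<in> admissible v1 v2.
        (\<integral>\<epsilon>. a \<bullet> (X *\<^sub>v \<tau> + vec (dim_row X) \<epsilon>) \<partial>(error_distribution (dim_row X) \<sigma>)) = c \<bullet> \<tau>)"

definition Omega :: "nat \<Rightarrow> nat \<Rightarrow> nat \<Rightarrow> nat \<Rightarrow> nat \<Rightarrow> nat \<Rightarrow> real mat set" where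
  "Omega v1 v2 N k1 k2 \<mu> = {X \<in> carrier_mat N (v1 * v2).
     (\<forall>c<v1 * v2. card {k. k < N \<and> X $$ (k, c) = 1} = \<mu>) \<and>
     (\<exists>B. (\<forall>k<N. semi_regular v1 v2 k1 k2 (B k)) \<and> X = design_matrix v1 v2 N B) \<and>
     (\<forall>i j i' j'. i < j \<and> j < v1 \<and> i' < j' \<and> j' < v2 \<longrightarrow>
        estimable v1 v2 X (kron_vec (contrast_vec v1 i j) (contrast_vec v2 i' j')))}"

definition semi_regular_SBBD ::
    "nat \<Rightarrow> nat \<Rightarrow> nat \<Rightarrow> nat \<Rightarrow> nat \<Rightarrow> nat \<Rightarrow> (nat \<Rightarrow> (nat \<times> nat) set) \<Rightarrow> bool" where
  "semi_regular_SBBD v1 v2 N k1 k2 \<mu> B \<longleftrightarrow>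
     (\<forall>k<N. B k \<subseteq> edges v1 v2) \<and>
     design_matrix v1 v2 N B \<in> Omega v1 v2 N k1 k2 \<mu> \<and>
     (\<exists>l12 l21 l22 :: int.
        (\<forall>k<N. (\<forall>i<v1. \<exists>j. (i, j) \<in> B k) \<and> (\<forall>j<v2. \<exists>i. (i, j) \<in> B k)) \<and>
        (\<forall>i<v1. \<forall>j<v2. card {k. k < N \<and> (i, j) \<in> B k} = \<mu>) \<and>
        (\<forall>i<v1. \<forall>j<v2. \<forall>j'<v2. j \<noteq> j' \<longrightarrow>
           int (card {k. k < N \<and> (i, j) \<in> B k \<and> (i, j') \<in> B k}) = l12) \<and>
        (\<forall>i<v1. \<forall>i'<v1. \<forall>j<v2. i \<noteq> i' \<longrightarrow>
           int (card {k. k < N \<and> (i, j) \<in> B k \<and> (i', j) \<in> B k}) = l21) \<and>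
        (\<forall>i<v1. \<forall>i'<v1. \<forall>j<v2. \<forall>j'<v2. i \<noteq> i' \<and> j \<noteq> j' \<longrightarrow>
           int (card {k. k < N \<and> (i, j) \<in> B k \<and> (i', j') \<in> B k}) = l22))"

definition contrast_eigensystem ::
    "nat \<Rightarrow> nat \<Rightarrow> real mat \<Rightarrow> (nat \<Rightarrow> real vec) \<Rightarrow> (nat \<Rightarrow> real) \<Rightarrow> bool" where
  "contrast_eigensystem v1 v2 X u \<alpha> \<longleftrightarrow>
     (\<forall>i<(v1 - 1) * (v2 - 1).
        eigenvector (transpose_mat X * X) (u i) (\<alpha> i) \<and>
        (\<forall>j<(v1 - 1) * (v2 - 1). u i \<bullet> u j = (if i = j then 1 else 0)) \<and>
        u i \<bullet> ones (v1 * v2) = 0 \<and>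
        (\<forall>z \<in> carrier_vec v1. z \<bullet> ones v1 = 0 \<longrightarrow> u i \<bullet> kron_vec z (ones v2) = 0) \<and>
        (\<forall>w \<in> carrier_vec v2. w \<bullet> ones v2 = 0 \<longrightarrow> u i \<bullet> kron_vec (ones v1) w = 0))"

text \<open>
  Every member of \<open>Omega\<close> has such an eigensystem, by the spectral theorem for the symmetric matrix
  \<open>X\<^sup>t X\<close>, and the multiset of the \<open>\<alpha> i\<close> does not depend on its choice. Optimality compares the values
  of the criterion for all choices, so no particular one has to be singled out.
\<close>

definition A_optimum :: "nat \<Rightarrow> nat \<Rightarrow> nat \<Rightarrow> nat \<Rightarrow> nat \<Rightarrow> nat \<Rightarrow> real mat \<Rightarrow> bool" where
  "A_optimum v1 v2 N k1 k2 \<mu> X \<longleftrightarrow>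
     X \<in> Omega v1 v2 N k1 k2 \<mu> \<and>
     (\<forall>X' \<in> Omega v1 v2 N k1 k2 \<mu>. \<forall>u \<alpha> u' \<alpha>'.
        contrast_eigensystem v1 v2 X u \<alpha> \<longrightarrow> contrast_eigensystem v1 v2 X' u' \<alpha>' \<longrightarrow>
        (\<Sum>i<(v1 - 1) * (v2 - 1). 1 / \<alpha> i) \<le> (\<Sum>i<(v1 - 1) * (v2 - 1). 1 / \<alpha>' i))"

end

theory Submission imports Defs begin

text \<open>
  Every row \<open>x\<close> of a matrix in \<open>\<Omega>\<close> satisfies \<open>x \<bullet> 1 = x \<bullet> x = v\<^sub>1 k\<^sub>1\<close>, so by Bessel's inequality
  for \<open>x - (k\<^sub>1 / v\<^sub>2) 1\<close> the sum of the \<open>\<alpha>\<^sub>i\<close> is at most \<open>v\<^sub>1 (v\<^sub>2 - k\<^sub>1) \<mu>\<close> on all of \<open>\<Omega>\<close>. For an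
  SBBD the Gram matrix \<open>X\<^sup>t X\<close> acts on the admissible vectors as the scalar
  \<open>\<mu> - \<lambda>\<^sub>1\<^sub>2 - \<lambda>\<^sub>2\<^sub>1 + \<lambda>\<^sub>2\<^sub>2\<close>, and counting shows that \<open>(v\<^sub>1 - 1)(v\<^sub>2 - 1)\<close> times this scalar attains the
  bound. Since \<open>1 / t\<close> is convex, the sum of the \<open>1 / \<alpha>\<^sub>i\<close> is least when all \<open>\<alpha>\<^sub>i\<close> are equal and
  their sum is as large as possible.
\<close>

section \<open>Sums over the lexicographical index and Bessel's inequality\<close>

lemma sum_lex:
  fixes f :: "nat \<Rightarrow> 'a::comm_monoid_add"
  shows "(\<Sum>c<m * n. f c) = (\<Sum>i<m. \<Sum>j<n. f (i * n + j))"
proof -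
  have "sum f {i * n..<i * n + n} = (\<Sum>j<n. f (i * n + j))" for i
    using sum.shift_bounds_nat_ivl[of f 0 "i * n" n]
    by (simp add: add.commute lessThan_atLeast0)
  then show ?thesis
    by (simp add: sum.nat_group[symmetric])
qed

lemma lex_index_less:
  fixes i j m n :: nat
  assumes "i < m" "j < n"
  shows "i * n + j < m * n"
proof -
  have "i * n + j < Suc i * n" using assms(2) by simp
  also have "\<dots> \<le> m * n" using assms(1) by (intro mult_le_mono1) simp
  finally show ?thesis .
qed

lemma scalar_prod_lessThan:
  assumes "w \<in> carrier_vec n"
  shows "v \<bullet> w = (\<Sum>c<n. v $ c * w $ c)"
  using assms by (simp add: scalar_prod_def lessThan_atLeast0)

text \<open>With \<open>z\<close> the orthogonal projection of \<open>y\<close> onto the span of the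
  \<open>u i\<close>, both the inner product of \<open>y\<close> and \<open>z\<close> and the
  squared norm of \<open>z\<close> equal the sum of the squared coefficients. The claim is then
  nonnegativity of the squared norm of \<open>y - z\<close>.\<close>

lemma bessel_sum:
  fixes y :: "'b \<Rightarrow> real" and u :: "'a \<Rightarrow> 'b \<Rightarrow> real"
  assumes "finite I"
    and orth: "\<And>i j. i \<in> I \<Longrightarrow> j \<in> I \<Longrightarrow> (\<Sum>c\<in>C. u i c * u j c) = (if i = j then 1 else 0)"
  shows "(\<Sum>i\<in>I. (\<Sum>c\<in>C. y c * u i c)\<^sup>2) \<le> (\<Sum>c\<in>C. (y c)\<^sup>2)"
proof -
  define p where "p i = (\<Sum>c\<in>C. y c * u i c)" for i
  define z where "z c = (\<Sum>i\<in>I. p i * u i c)" for c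
  have yz: "(\<Sum>c\<in>C. y c * z c) = (\<Sum>i\<in>I. (p i)\<^sup>2)"
  proof -
    have "(\<Sum>c\<in>C. y c * z c) = (\<Sum>c\<in>C. \<Sum>i\<in>I. p i * (y c * u i c))"
      by (simp add: z_def sum_distrib_left mult_ac)
    also have "\<dots> = (\<Sum>i\<in>I. \<Sum>c\<in>C. p i * (y c * u i c))" by (rule sum.swap)
    finally show ?thesis
      by (simp add: sum_distrib_left[symmetric] p_def[symmetric] power2_eq_square)
  qed
  have uz: "(\<Sum>c\<in>C. u i c * z c) = p i" if "i \<in> I" for i
  proof -
    have "(\<Sum>c\<in>C. u i c * z c) = (\<Sum>c\<in>C. \<Sum>j\<in>I. p j * (u i c * u j c))"
      by (simp add: z_def sum_distrib_left mult_ac)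
    also have "\<dots> = (\<Sum>j\<in>I. \<Sum>c\<in>C. p j * (u i c * u j c))" by (rule sum.swap)
    also have "\<dots> = (\<Sum>j\<in>I. p j * (if i = j then 1 else 0))"
      using that by (simp add: sum_distrib_left[symmetric] orth)
    finally show ?thesis using that \<open>finite I\<close>
      by (simp add: if_distrib[of "\<lambda>x. _ * x"] cong: if_cong)
  qed
  have zz: "(\<Sum>c\<in>C. z c * z c) = (\<Sum>i\<in>I. (p i)\<^sup>2)"
  proof -
    have "(\<Sum>c\<in>C. z c * z c) = (\<Sum>c\<in>C. \<Sum>i\<in>I. p i * (u i c * z c))"
      \<comment> \<open>Only one factor \<open>z\<close> is expanded; the other is kept so that
        \<open>uz\<close> can evaluate it against \<open>u i\<close>.\<close>
      by (subst (2) z_def) (simp add: sum_distrib_left mult_ac)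
    also have "\<dots> = (\<Sum>i\<in>I. \<Sum>c\<in>C. p i * (u i c * z c))" by (rule sum.swap)
    finally show ?thesis
      by (simp add: sum_distrib_left[symmetric] uz power2_eq_square)
  qed
  have "0 \<le> (\<Sum>c\<in>C. (y c - z c)\<^sup>2)" by (intro sum_nonneg) simp
  also have "\<dots> = (\<Sum>c\<in>C. (y c)\<^sup>2 - 2 * (y c * z c) + z c * z c)"
    by (simp add: power2_eq_square algebra_simps)
  also have "\<dots> = (\<Sum>c\<in>C. (y c)\<^sup>2) - 2 * (\<Sum>c\<in>C. y c * z c) + (\<Sum>c\<in>C. z c * z c)"
    by (simp add: sum.distrib sum_subtractf sum_distrib_left)
  finally show ?thesis using yz zz by (simp add: p_def)
qed

section \<open>Contrast eigenvectors and positivity of their eigenvalues\<close>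

text \<open>A row sum is tested with a unit vector made orthogonal to the all-ones vector by
  subtracting its mean 1/\<open>v1\<close>. The mean contributes only a multiple of the total sum,
  which vanishes because \<open>u s\<close> is orthogonal to the all-ones vector. Columns are
  treated in the same way.\<close>

lemma contrast_eigensystem_admissible:
  assumes es: "contrast_eigensystem v1 v2 X u \<alpha>" and X: "X \<in> carrier_mat N (v1 * v2)"
    and s: "s < (v1 - 1) * (v2 - 1)"
  shows "u s \<in> admissible v1 v2"
proof -
  have pos: "v1 > 0" "v2 > 0" using s by (auto intro: gr0I)
  have ev: "eigenvector (transpose_mat X * X) (u s) (\<alpha> s)"
    and one: "u s \<bullet> ones (v1 * v2) = 0"
    and rows: "\<And>z. z \<in> carrier_vec v1 \<Longrightarrow> z \<bullet> ones v1 = 0 \<Longrightarrow> u s \<bullet> kron_vec z (ones v2) = 0"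
    and cols: "\<And>w. w \<in> carrier_vec v2 \<Longrightarrow> w \<bullet> ones v2 = 0 \<Longrightarrow> u s \<bullet> kron_vec (ones v1) w = 0"
    using es s unfolding contrast_eigensystem_def by blast+
  have carr: "u s \<in> carrier_vec (v1 * v2)" using ev X by (simp add: eigenvector_def)
  have kron: "u s \<bullet> kron_vec z w = (\<Sum>i<v1. \<Sum>j<v2. u s $ (i * v2 + j) * (z $ i * w $ j))"
    if "z \<in> carrier_vec v1" "w \<in> carrier_vec v2" for z w
  proof -
    have "kron_vec z w \<in> carrier_vec (v1 * v2)"
      using that by (intro carrier_vecI) (simp add: kron_vec_def)
    then show ?thesis using that
      by (simp add: scalar_prod_lessThan sum_lex kron_vec_def lex_index_less)
  qed
  have tot: "(\<Sum>i<v1. \<Sum>j<v2. u s $ (i * v2 + j)) = 0"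
    using one by (simp add: scalar_prod_lessThan[of _ "v1 * v2"] ones_def sum_lex lex_index_less)
  have "(\<Sum>j<v2. u s $ (a * v2 + j)) = 0" if a: "a < v1" for a
  proof -
    define z where "z = vec v1 (\<lambda>l. (if l = a then 1 else 0) - 1 / real v1)"
    have "z \<bullet> ones v1 = 0" using a pos
      by (simp add: scalar_prod_lessThan[of _ v1] z_def ones_def sum_subtractf)
    then have "0 = u s \<bullet> kron_vec z (ones v2)"
      using rows[of z] by (simp add: z_def)
    also have "\<dots> = (\<Sum>i<v1. ((if i = a then 1 else 0) - 1 / real v1) * (\<Sum>j<v2. u s $ (i * v2 + j)))"
      by (subst kron) (simp_all add: z_def ones_def sum_distrib_left mult_ac)
    also have "\<dots> = (\<Sum>j<v2. u s $ (a * v2 + j)) - 1 / real v1 * (\<Sum>i<v1. \<Sum>j<v2. u s $ (i * v2 + j))"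
      using a by (simp add: left_diff_distrib sum_subtractf sum_distrib_left[symmetric] sum_divide_distrib
          if_distrib[of "\<lambda>x. x * _"] cong: if_cong)
    finally show ?thesis using tot by simp
  qed
  moreover have "(\<Sum>i<v1. u s $ (i * v2 + b)) = 0" if b: "b < v2" for b
  proof -
    define w where "w = vec v2 (\<lambda>l. (if l = b then 1 else 0) - 1 / real v2)"
    have "w \<bullet> ones v2 = 0" using b pos
      by (simp add: scalar_prod_lessThan[of _ v2] w_def ones_def sum_subtractf)
    then have "0 = u s \<bullet> kron_vec (ones v1) w"
      using cols[of w] by (simp add: w_def)
    also have "\<dots> = (\<Sum>i<v1. \<Sum>j<v2. u s $ (i * v2 + j) * ((if j = b then 1 else 0) - 1 / real v2))"
      by (subst kron) (simp_all add: w_def ones_def)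
    also have "\<dots> = (\<Sum>i<v1. u s $ (i * v2 + b)) - (\<Sum>i<v1. \<Sum>j<v2. u s $ (i * v2 + j)) * (1 / real v2)"
      using b by (simp add: right_diff_distrib sum_subtractf sum_distrib_right sum_divide_distrib
          if_distrib[of "\<lambda>x. _ * x"] cong: if_cong)
    finally show ?thesis using tot by simp
  qed
  ultimately show ?thesis using carr by (simp add: admissible_def)
qed

text \<open>Bracketing the product as the transpose of \<open>X\<close> applied to
  \<open>X u\<close> makes the eigenvalue equation a sum over blocks, which can later be exchanged
  with sums over edges.\<close>

lemma gram_eigenvector_entry:
  assumes "eigenvector (transpose_mat X * X) u a" and X: "X \<in> carrier_mat N n" and c: "c < n"
  shows "(\<Sum>k<N. X $$ (k, c) * (\<Sum>d<n. X $$ (k, d) * u $ d)) = a * u $ c"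
proof -
  have u: "u \<in> carrier_vec n" and eq: "(transpose_mat X * X) *\<^sub>v u = a \<cdot>\<^sub>v u"
    using assms by (auto simp: eigenvector_def)
  have "(transpose_mat X * X) *\<^sub>v u = transpose_mat X *\<^sub>v (X *\<^sub>v u)"
    using X u by (intro assoc_mult_mat_vec) auto
  then have "(transpose_mat X *\<^sub>v (X *\<^sub>v u)) $ c = a * u $ c"
    unfolding eq using c u by (metis carrier_vecD index_smult_vec(1))
  then show ?thesis using X u c
    by (simp add: scalar_prod_def lessThan_atLeast0)
qed

text \<open>Pairing the eigenvalue equation with the unit vector \<open>u\<close> gives the
  eigenvalue as the squared norm of \<open>X u\<close>.\<close>

lemma gram_eigenvalue_eq_norm:
  assumes ev: "eigenvector (transpose_mat X * X) u a" and X: "X \<in> carrier_mat N n"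
    and unit: "u \<bullet> u = 1"
  shows "a = (\<Sum>k<N. (\<Sum>d<n. X $$ (k, d) * u $ d)\<^sup>2)"
proof -
  have u: "u \<in> carrier_vec n" using ev X by (auto simp: eigenvector_def)
  have "a = (\<Sum>c<n. u $ c * (a * u $ c))"
    using unit u by (simp add: scalar_prod_lessThan sum_distrib_left[symmetric] mult.left_commute)
  also have "\<dots> = (\<Sum>c<n. \<Sum>k<N. u $ c * (X $$ (k, c) * (\<Sum>d<n. X $$ (k, d) * u $ d)))"
    by (simp add: gram_eigenvector_entry[OF ev X, symmetric] sum_distrib_left)
  also have "\<dots> = (\<Sum>k<N. \<Sum>c<n. u $ c * (X $$ (k, c) * (\<Sum>d<n. X $$ (k, d) * u $ d)))"
    by (rule sum.swap)
  also have "\<dots> = (\<Sum>k<N. (\<Sum>c<n. X $$ (k, c) * u $ c) * (\<Sum>d<n. X $$ (k, d) * u $ d))"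
    by (simp add: sum_distrib_right mult_ac)
  finally show ?thesis by (simp add: power2_eq_square)
qed

text \<open>An estimable function vanishes on the admissible part of the kernel of \<open>X\<close>; the expectation
  itself need not be evaluated, as it depends on \<open>\<tau>\<close> only through \<open>X \<tau>\<close>.\<close>

lemma estimable_kernel:
  assumes est: "estimable v1 v2 X c" and X: "X \<in> carrier_mat N (v1 * v2)"
    and c: "c \<in> carrier_vec (v1 * v2)"
    and t: "t \<in> admissible v1 v2" and ker: "X *\<^sub>v t = 0\<^sub>v N"
  shows "c \<bullet> t = 0"
proof -
  \<comment> \<open>Unbiasedness is used at \<sigma> = 1, once for \<open>t\<close> and once for the
    zero vector, which have the same image under \<open>X\<close>.\<close>
  define E where "E a t = (\<integral>\<epsilon>. a \<bullet> (X *\<^sub>v t + vec (dim_row X) \<epsilon>) \<partial>(error_distribution (dim_row X) 1))"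
    for a t
  obtain a where "\<forall>\<sigma>>0. \<forall>t\<in>admissible v1 v2.
      (\<integral>\<epsilon>. a \<bullet> (X *\<^sub>v t + vec (dim_row X) \<epsilon>) \<partial>(error_distribution (dim_row X) \<sigma>)) = c \<bullet> t"
    using est unfolding estimable_def by blast
  then have a: "E a t = c \<bullet> t" if "t \<in> admissible v1 v2" for t
    using that by (simp add: E_def)
  have z: "0\<^sub>v (v1 * v2) \<in> admissible v1 v2"
    by (simp add: admissible_def lex_index_less)
  have "X *\<^sub>v 0\<^sub>v (v1 * v2) = 0\<^sub>v N" using X by auto
  then have "E a t = E a (0\<^sub>v (v1 * v2))" by (simp add: E_def ker)
  then show ?thesis using a[OF t] a[OF z] c by simp
qed

lemma contrast_scalar_prod:
  assumes "t \<in> carrier_vec (v1 * v2)" "i < v1" "j < v1" "i \<noteq> j" "i' < v2" "j' < v2" "i' \<noteq> j'"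
  shows "kron_vec (contrast_vec v1 i j) (contrast_vec v2 i' j') \<bullet> t =
    t $ (i * v2 + i') - t $ (i * v2 + j') - t $ (j * v2 + i') + t $ (j * v2 + j')"
proof -
  define e where "e i l = (if l = i then 1 else 0 :: real)" for i l :: nat
  \<comment> \<open>The indices must differ: for equal ones the nested conditional in
    \<open>contrast_vec\<close> yields 1 at that index, while the difference of the two Kronecker
    deltas is 0.\<close>
  have ce: "contrast_vec v i j = vec v (\<lambda>l. e i l - e j l)" if "i \<noteq> j" for v i j
    using that by (auto simp: contrast_vec_def e_def)
  have e1: "(\<Sum>l<n. e i l * f l) = f i" if "i < n" for i n and f :: "nat \<Rightarrow> real"
    using that by (simp add: e_def if_distrib[of "\<lambda>x. x * _"] cong: if_cong)
  have "kron_vec (contrast_vec v1 i j) (contrast_vec v2 i' j') \<bullet> t =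
    (\<Sum>a<v1. \<Sum>b<v2. (e i a - e j a) * (e i' b - e j' b) * t $ (a * v2 + b))"
    using assms by (simp add: scalar_prod_lessThan sum_lex kron_vec_def lex_index_less ce)
  also have "\<dots> = (\<Sum>a<v1. (e i a - e j a) * (\<Sum>b<v2. (e i' b - e j' b) * t $ (a * v2 + b)))"
    by (simp add: sum_distrib_left mult_ac)
  also have "\<dots> = (\<Sum>a<v1. (e i a - e j a) * (t $ (a * v2 + i') - t $ (a * v2 + j')))"
    using assms by (simp add: left_diff_distrib sum_subtractf e1)
  also have "\<dots> = t $ (i * v2 + i') - t $ (i * v2 + j') - (t $ (j * v2 + i') - t $ (j * v2 + j'))"
    using assms by (simp only: left_diff_distrib[of "e _ _"] sum_subtractf e1)
  finally show ?thesis by simp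
qed

text \<open>This is how (C3) enters: \<open>X\<close> is injective on the admissible vectors. All
  elementary contrasts vanish at \<open>t\<close> by estimability, and they determine an admissible
  vector.\<close>

lemma admissible_kernel_zero:
  assumes X: "X \<in> Omega v1 v2 N k1 k2 \<mu>" and t: "t \<in> admissible v1 v2" and ker: "X *\<^sub>v t = 0\<^sub>v N"
  shows "t = 0\<^sub>v (v1 * v2)"
proof -
  define f where "f i j = t $ (i * v2 + j)" for i j
  have tc: "t \<in> carrier_vec (v1 * v2)" and
    rows: "\<And>i. i < v1 \<Longrightarrow> (\<Sum>j<v2. f i j) = 0" and cols: "\<And>j. j < v2 \<Longrightarrow> (\<Sum>i<v1. f i j) = 0"
    using t by (auto simp: admissible_def f_def)
  have Xc: "X \<in> carrier_mat N (v1 * v2)" using X by (simp add: Omega_def)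
  have ord: "f i i' - f i j' - f j i' + f j j' = 0"
    if "i < j" "j < v1" "i' < j'" "j' < v2" for i j i' j'
  proof -
    have "estimable v1 v2 X (kron_vec (contrast_vec v1 i j) (contrast_vec v2 i' j'))"
      using X that by (simp add: Omega_def)
    then have "kron_vec (contrast_vec v1 i j) (contrast_vec v2 i' j') \<bullet> t = 0"
      by (rule estimable_kernel[OF _ Xc _ t ker])
        (intro carrier_vecI, simp add: kron_vec_def contrast_vec_def)
    then show ?thesis using that contrast_scalar_prod[OF tc, of i j i' j'] by (simp add: f_def)
  qed
  \<comment> \<open>(C3) speaks only of ordered pairs, but the expression changes sign when either
    pair is swapped and is zero when a pair coincides.\<close>
  have all: "f i i' - f i j' - f j i' + f j j' = 0"
    if "i < v1" "j < v1" "i' < v2" "j' < v2" for i j i' j'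
    using ord[of i j i' j'] ord[of j i i' j'] ord[of i j j' i'] ord[of j i j' i'] that
    by (cases i j rule: linorder_cases; cases i' j' rule: linorder_cases) simp_all
  have "f i i' = 0" if i: "i < v1" "i' < v2" for i i'
  proof -
    \<comment> \<open>Summing over all \<open>j\<close> and \<open>j'\<close> turns three of the
      four terms into multiples of row, column or total sums, which vanish.\<close>
    have "0 = (\<Sum>j<v1. \<Sum>j'<v2. f i i' - f i j' - f j i' + f j j')"
      using all i by simp
    also have "\<dots> = real v1 * real v2 * f i i' - real v1 * (\<Sum>j'<v2. f i j')
        - real v2 * (\<Sum>j<v1. f j i') + (\<Sum>j<v1. \<Sum>j'<v2. f j j')"
      by (simp add: sum.distrib sum_subtractf sum_distrib_left[symmetric] algebra_simps)
    finally show ?thesis using i rows cols by simp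
  qed
  then have "t $ c = 0" if "c < v1 * v2" for c
    using that by (metis f_def div_mult_mod_eq less_mult_imp_div_less mod_less_divisor
        mult_0_right not_gr_zero not_less_zero)
  then show ?thesis using tc by auto
qed

text \<open>The eigenvalue is the squared norm of \<open>X (u s)\<close>. If it were 0, then
  \<open>u s\<close> would be an admissible vector in the kernel of \<open>X\<close>, hence zero,
  although it has norm 1.\<close>

lemma contrast_eigenvalue_pos:
  assumes X: "X \<in> Omega v1 v2 N k1 k2 \<mu>" and es: "contrast_eigensystem v1 v2 X u \<alpha>"
    and s: "s < (v1 - 1) * (v2 - 1)"
  shows "\<alpha> s > 0"
proof -
  have Xc: "X \<in> carrier_mat N (v1 * v2)" using X by (simp add: Omega_def)
  have ev: "eigenvector (transpose_mat X * X) (u s) (\<alpha> s)" and unit: "u s \<bullet> u s = 1"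
    using es s by (simp_all add: contrast_eigensystem_def)
  have uc: "u s \<in> carrier_vec (v1 * v2)" using ev Xc by (simp add: eigenvector_def)
  note eq = gram_eigenvalue_eq_norm[OF ev Xc unit]
  have "\<alpha> s \<ge> 0" unfolding eq by (intro sum_nonneg) simp
  moreover have "\<alpha> s \<noteq> 0"
  proof
    assume "\<alpha> s = 0"
    then have "\<forall>k\<in>{..<N}. (\<Sum>d<v1 * v2. X $$ (k, d) * u s $ d)\<^sup>2 = 0"
      using eq by (subst sum_nonneg_eq_0_iff[symmetric]) simp_all
    then have "X *\<^sub>v u s = 0\<^sub>v N"
      using Xc uc by (auto simp: scalar_prod_def lessThan_atLeast0)
    from admissible_kernel_zero[OF X contrast_eigensystem_admissible[OF es Xc s] this]
    show False using unit by simp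
  qed
  ultimately show ?thesis by simp
qed

section \<open>Degree counts and the upper bound for the eigenvalue sum\<close>

text \<open>The degrees in \<open>semi_regular\<close> count neighbours among all natural numbers;
  the second assumption reconciles this with a sum over a bounded index set.\<close>

lemma sum_indicator_pair:
  fixes H :: "('a \<times> 'b) set"
  assumes "finite A" "\<And>j. (i, j) \<in> H \<Longrightarrow> j \<in> A"
  shows "(\<Sum>j\<in>A. if (i, j) \<in> H then 1 else 0 :: real) = card {j. (i, j) \<in> H}"
proof -
  have "A \<inter> {j. (i, j) \<in> H} = {j. (i, j) \<in> H}" using assms(2) by auto
  then show ?thesis using assms(1) by (simp add: sum.If_cases)
qed

lemma semi_regular_row_sum:
  assumes "semi_regular v1 v2 k1 k2 H" "i < v1"
  shows "(\<Sum>j<v2. if (i, j) \<in> H then 1 else 0 :: real) = k1"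
  using assms by (subst sum_indicator_pair) (auto simp: semi_regular_def edges_def)

lemma semi_regular_col_sum:
  assumes "semi_regular v1 v2 k1 k2 H" "j < v2"
  shows "(\<Sum>i<v1. if (i, j) \<in> H then 1 else 0 :: real) = k2"
  \<comment> \<open>Degrees on the second side are degrees on the first side of the converse
    relation.\<close>
  using assms sum_indicator_pair[of "{..<v1}" j "H\<inverse>"]
  by (auto simp: semi_regular_def edges_def)

lemma design_matrix_lex:
  assumes "k < N" "i < v1" "j < v2"
  shows "design_matrix v1 v2 N B $$ (k, i * v2 + j) = (if (i, j) \<in> B k then 1 else 0)"
  using assms by (simp add: design_matrix_def lex_index_less)

text \<open>Incidences of blocks with the edges at the point 0 of the first side are counted twice:
  each of the \<open>N\<close> blocks contains \<open>k1\<close> of these edges, and each of the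
  \<open>v2\<close> edges lies in \<mu> blocks.\<close>

lemma design_count:
  assumes sr: "\<And>k. k < N \<Longrightarrow> semi_regular v1 v2 k1 k2 (B k)"
    and deg: "\<And>c. c < v1 * v2 \<Longrightarrow> card {k. k < N \<and> design_matrix v1 v2 N B $$ (k, c) = 1} = \<mu>"
    and "v1 > 0"
  shows "real N * real k1 = real v2 * real \<mu>"
proof -
  have "(\<Sum>k<N. if (0, j) \<in> B k then 1 else 0 :: real) = \<mu>" if "j < v2" for j
  proof -
    have "(\<Sum>k<N. if (0, j) \<in> B k then 1 else 0 :: real) = card {k. k < N \<and> (0, j) \<in> B k}"
      by (simp add: sum.If_cases Int_def)
    also have "{k. k < N \<and> (0, j) \<in> B k} = {k. k < N \<and> design_matrix v1 v2 N B $$ (k, 0 * v2 + j) = 1}"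
      using \<open>v1 > 0\<close> that design_matrix_lex[of _ N 0 v1 j v2 B] by (auto split: if_splits)
    also have "card \<dots> = \<mu>" by (rule deg) (rule lex_index_less[OF \<open>v1 > 0\<close> that])
    finally show ?thesis .
  qed
  then have "real v2 * \<mu> = (\<Sum>j<v2. \<Sum>k<N. if (0, j) \<in> B k then 1 else 0 :: real)" by simp
  also have "\<dots> = (\<Sum>k<N. \<Sum>j<v2. if (0, j) \<in> B k then 1 else 0 :: real)" by (rule sum.swap)
  also have "\<dots> = real N * real k1"
    using semi_regular_row_sum[OF sr \<open>v1 > 0\<close>] by simp
  finally show ?thesis by simp
qed

text \<open>As a sum of squared norms, the eigenvalue sum can be rearranged by rows of
  \<open>X\<close>: each row contributes its squared coefficients with respect to the orthonormal
  \<open>u s\<close>. Bessel's inequality bounds this contribution, and \<open>design_count\<close>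
  eliminates \<open>N\<close>.\<close>

lemma sum_contrast_eigenvalues_le:
  assumes X: "X \<in> Omega v1 v2 N k1 k2 \<mu>" and es: "contrast_eigensystem v1 v2 X u \<alpha>"
    and pos: "v1 > 0" "v2 > 0"
  shows "(\<Sum>s<(v1 - 1) * (v2 - 1). \<alpha> s) \<le> real v1 * (real v2 - real k1) * real \<mu>"
proof -
  define n where "n = (v1 - 1) * (v2 - 1)"
  \<comment> \<open>The mean entry of a row, which has \<open>v1 * k1\<close> ones among
    \<open>v1 * v2\<close> entries.\<close>
  define q where "q = real k1 / real v2"
  have Xc: "X \<in> carrier_mat N (v1 * v2)" using X by (simp add: Omega_def)
  obtain B where sr: "\<And>k. k < N \<Longrightarrow> semi_regular v1 v2 k1 k2 (B k)" and XB: "X = design_matrix v1 v2 N B"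
    and deg: "\<And>c. c < v1 * v2 \<Longrightarrow> card {k. k < N \<and> design_matrix v1 v2 N B $$ (k, c) = 1} = \<mu>"
    using X by (auto simp: Omega_def)
  have ev: "eigenvector (transpose_mat X * X) (u s) (\<alpha> s)" 
    and orth: "\<And>t. t < n \<Longrightarrow> u s \<bullet> u t = (if s = t then 1 else 0)"
    and one: "u s \<bullet> ones (v1 * v2) = 0" if "s < n" for s
    using es that by (simp_all add: contrast_eigensystem_def n_def)
  have uc: "u s \<in> carrier_vec (v1 * v2)" if "s < n" for s
    using ev[OF that] Xc by (simp add: eigenvector_def)
  have orth': "(\<Sum>c<v1 * v2. u s $ c * u t $ c) = (if s = t then 1 else 0)" if "s < n" "t < n" for s t
    using orth[OF that] uc[OF that(2)] by (simp add: scalar_prod_lessThan)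
  have one': "(\<Sum>c<v1 * v2. u s $ c) = 0" if "s < n" for s
    using one[OF that] by (simp add: scalar_prod_lessThan[of _ "v1 * v2"] ones_def)
  have row: "(\<Sum>s<n. (\<Sum>c<v1 * v2. X $$ (k, c) * u s $ c)\<^sup>2) \<le> real v1 * k1 - real v1 * k1 * q"
    if k: "k < N" for k
  proof -
    have sum1: "(\<Sum>c<v1 * v2. X $$ (k, c)) = real v1 * k1"
      using semi_regular_row_sum[OF sr[OF k]] k by (simp add: XB sum_lex design_matrix_lex)
    have sq: "(X $$ (k, c))\<^sup>2 = X $$ (k, c)" if "c < v1 * v2" for c
      using that k by (simp add: XB design_matrix_def)
    \<comment> \<open>Centring the row leaves the coefficients unchanged, since \<open>u s\<close>
      is orthogonal to the all-ones vector, but makes the bound sharp enough.\<close>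
    have "(\<Sum>s<n. (\<Sum>c<v1 * v2. X $$ (k, c) * u s $ c)\<^sup>2) =
        (\<Sum>s<n. (\<Sum>c<v1 * v2. (X $$ (k, c) - q) * u s $ c)\<^sup>2)"
      by (simp add: left_diff_distrib sum_subtractf sum_distrib_left[symmetric] one')
    also have "\<dots> \<le> (\<Sum>c<v1 * v2. (X $$ (k, c) - q)\<^sup>2)"
      by (rule bessel_sum) (simp_all add: orth')
    also have "\<dots> = (\<Sum>c<v1 * v2. X $$ (k, c) - 2 * q * X $$ (k, c) + q\<^sup>2)"
      by (intro sum.cong) (simp_all add: power2_diff sq)
    also have "\<dots> = real v1 * k1 - 2 * q * (real v1 * k1) + real v1 * real v2 * q\<^sup>2"
      by (simp add: sum.distrib sum_subtractf sum_distrib_left[symmetric] sum1)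
    also have "\<dots> = real v1 * k1 - real v1 * k1 * q"
      using pos by (simp add: q_def power2_eq_square field_simps)
    finally show ?thesis .
  qed
  have count: "real N * real k1 = real v2 * real \<mu>"
    by (rule design_count) (use sr deg pos in auto)
  have "(\<Sum>s<n. \<alpha> s) = (\<Sum>s<n. \<Sum>k<N. (\<Sum>c<v1 * v2. X $$ (k, c) * u s $ c)\<^sup>2)"
    by (intro sum.cong refl gram_eigenvalue_eq_norm) (use ev Xc orth in auto)
  also have "\<dots> = (\<Sum>k<N. \<Sum>s<n. (\<Sum>c<v1 * v2. X $$ (k, c) * u s $ c)\<^sup>2)"
    by (rule sum.swap)
  also have "\<dots> \<le> (\<Sum>k<N. real v1 * k1 - real v1 * k1 * q)"
    by (intro sum_mono) (simp add: row)
  also have "\<dots> = (real N * real k1) * (real v1 * (1 - q))"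
    by (simp add: algebra_simps)
  also have "\<dots> = real v1 * (real v2 - real k1) * real \<mu>"
    unfolding count using pos by (simp add: q_def field_simps)
  finally show ?thesis by (simp add: n_def)
qed

section \<open>The Gram matrix of a semi-regular SBBD\<close>

text \<open>With I and J the identity and all-ones matrices of fitting sizes, the Gram matrix is a
  combination of the Kronecker products of I with I, I with J, J with I and J with J. On admissible
  vectors only the first survives, so its coefficient \<open>a\<close> is the common eigenvalue.
  Comparing Gram row sums with block degrees determines \<open>a\<close>.\<close>

lemma SBBD_eigenvalues:
  assumes sb: "semi_regular_SBBD v1 v2 N k1 k2 \<mu> B" and kk: "v1 * k1 = v2 * k2"
    and n: "(v1 - 1) * (v2 - 1) > 0"
  obtains a where "real ((v1 - 1) * (v2 - 1)) * a = real v1 * (real v2 - real k1) * real \<mu>"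
    and "\<And>u \<alpha> s. contrast_eigensystem v1 v2 (design_matrix v1 v2 N B) u \<alpha> \<Longrightarrow>
           s < (v1 - 1) * (v2 - 1) \<Longrightarrow> \<alpha> s = a"
proof -
  define X where "X = design_matrix v1 v2 N B"
  define x where "x k i j = (if (i, j) \<in> B k then 1 else 0 :: real)" for k i j
  define G where "G i j i' j' = (\<Sum>k<N. x k i j * x k i' j')" for i j i' j'
  have pos: "v1 > 0" "v2 > 0" using n by (auto intro: gr0I)
  have Xc: "X \<in> carrier_mat N (v1 * v2)" by (simp add: X_def design_matrix_def)
  have Xx: "X $$ (k, i * v2 + j) = x k i j" if "k < N" "i < v1" "j < v2" for k i j
    using that by (simp add: X_def x_def design_matrix_lex)
  have "X \<in> Omega v1 v2 N k1 k2 \<mu>" using sb by (simp add: semi_regular_SBBD_def X_def)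
  \<comment> \<open>Membership in \<open>Omega\<close> provides the degrees for some collection
    \<open>B'\<close> with the same design matrix; they are carried over to \<open>B\<close> entry
    by entry.\<close>
  then obtain B' where sr: "\<And>k. k < N \<Longrightarrow> semi_regular v1 v2 k1 k2 (B' k)"
    and XB: "X = design_matrix v1 v2 N B'"
    by (auto simp: Omega_def)
  have xB': "x k i j = (if (i, j) \<in> B' k then 1 else 0)" if "k < N" "i < v1" "j < v2" for k i j
    using that design_matrix_lex[OF that, of B'] Xx[OF that] XB by simp
  have row: "(\<Sum>j<v2. x k i j) = k1" if "k < N" "i < v1" for k i
    using semi_regular_row_sum[OF sr that(2)] that by (simp add: xB')
  have col: "(\<Sum>i<v1. x k i j) = k2" if "k < N" "j < v2" for k j
    using semi_regular_col_sum[OF sr that(2)] that by (simp add: xB')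
  have Gcard: "G i j i' j' = card {k. k < N \<and> (i, j) \<in> B k \<and> (i', j') \<in> B k}" for i j i' j'
  proof -
    have "G i j i' j' = (\<Sum>k<N. if (i, j) \<in> B k \<and> (i', j') \<in> B k then 1 else 0)"
      by (auto simp: G_def x_def intro!: sum.cong)
    then show ?thesis by (simp add: sum.If_cases Int_def)
  qed
  obtain l12 l21 l22 :: int where
    mu: "\<forall>i<v1. \<forall>j<v2. card {k. k < N \<and> (i, j) \<in> B k} = \<mu>" and
    l12: "\<forall>i<v1. \<forall>j<v2. \<forall>j'<v2. j \<noteq> j' \<longrightarrow>
      int (card {k. k < N \<and> (i, j) \<in> B k \<and> (i, j') \<in> B k}) = l12" and
    l21: "\<forall>i<v1. \<forall>i'<v1. \<forall>j<v2. i \<noteq> i' \<longrightarrow>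
      int (card {k. k < N \<and> (i, j) \<in> B k \<and> (i', j) \<in> B k}) = l21" and
    l22: "\<forall>i<v1. \<forall>i'<v1. \<forall>j<v2. \<forall>j'<v2. i \<noteq> i' \<and> j \<noteq> j' \<longrightarrow>
      int (card {k. k < N \<and> (i, j) \<in> B k \<and> (i', j') \<in> B k}) = l22"
    using sb unfolding semi_regular_SBBD_def by (elim conjE exE) (rule that; assumption)
  define e where "e i l = (if l = i then 1 else 0 :: real)" for i l :: nat
  \<comment> \<open>These coefficients solve the four cases of \<open>G\<close> below:
    \<open>a + b + c + l22\<close> is \<mu> for equal edges, \<open>b + l22\<close> is
    \<open>l12\<close>, and \<open>c + l22\<close> is \<open>l21\<close>.\<close>
  define a where "a = real \<mu> - l12 - l21 + l22"
  define b where "b = real_of_int l12 - l22"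
  define c where "c = real_of_int l21 - l22"
  have e1: "(\<Sum>l<m. e i l * f l) = f i" if "i < m" for i m and f :: "nat \<Rightarrow> real"
    using that by (simp add: e_def if_distrib[of "\<lambda>x. x * _"] cong: if_cong)
  have e0: "(\<Sum>l<m. e i l) = 1" if "i < m" for i m
    using e1[OF that, of "\<lambda>_. 1"] by simp
  have G: "G i j i' j' = a * (e i i' * e j j') + b * e i i' + c * e j j' + l22"
    if "i < v1" "i' < v1" "j < v2" "j' < v2" for i j i' j'
    using mu[rule_format, of i j] l12[rule_format, of i j j'] l21[rule_format, of i i' j]
      l22[rule_format, of i i' j j'] that
    by (cases "i = i'"; cases "j = j'") (auto simp: Gcard e_def a_def b_def c_def)
  have Gu: "(\<Sum>i'<v1. \<Sum>j'<v2. G i j i' j' * f i' j') =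
      a * f i j + b * (\<Sum>j'<v2. f i j') + c * (\<Sum>i'<v1. f i' j) + l22 * (\<Sum>i'<v1. \<Sum>j'<v2. f i' j')"
    if i: "i < v1" "j < v2" for i j and f :: "nat \<Rightarrow> nat \<Rightarrow> real"
  proof -
    have "(\<Sum>i'<v1. \<Sum>j'<v2. G i j i' j' * f i' j') =
      (\<Sum>i'<v1. e i i' * (a * (\<Sum>j'<v2. e j j' * f i' j')) + e i i' * (b * (\<Sum>j'<v2. f i' j'))
        + (c * (\<Sum>j'<v2. e j j' * f i' j') + l22 * (\<Sum>j'<v2. f i' j')))"
      using i by (simp add: G sum_distrib_left distrib_left distrib_right sum.distrib mult_ac)
    also have "\<dots> = a * (\<Sum>j'<v2. e j j' * f i j') + b * (\<Sum>j'<v2. f i j')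
        + (c * (\<Sum>i'<v1. \<Sum>j'<v2. e j j' * f i' j') + l22 * (\<Sum>i'<v1. \<Sum>j'<v2. f i' j'))"
      by (simp only: sum.distrib e1[OF i(1)] sum_distrib_left[symmetric])
    finally show ?thesis using i by (simp add: e1)
  qed
  show thesis
  proof (rule that)
    have deg: "(\<Sum>k<N. x k 0 0) = \<mu>"
      using mu pos by (simp add: x_def sum.If_cases Int_def)
    \<comment> \<open>Each of the \<mu> blocks through the edge (0, 0) contains \<open>k1\<close>
      edges at the point 0 of the first side, \<open>k2\<close> at the point 0 of the second side,
      and \<open>v1 * k1\<close> edges in all. This gives \<open>r\<close>, \<open>s\<close> and
      \<open>t\<close>.\<close>
    have r: "(\<Sum>j'<v2. G 0 0 0 j') = k1 * \<mu>"
    proof -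
      have "(\<Sum>j'<v2. G 0 0 0 j') = (\<Sum>k<N. \<Sum>j'<v2. x k 0 0 * x k 0 j')"
        unfolding G_def by (rule sum.swap)
      also have "\<dots> = (\<Sum>k<N. x k 0 0 * k1)"
        by (simp add: sum_distrib_left[symmetric] row pos)
      finally show ?thesis by (simp add: sum_distrib_right[symmetric] deg)
    qed
    have s: "(\<Sum>i'<v1. G 0 0 i' 0) = k2 * \<mu>"
    proof -
      have "(\<Sum>i'<v1. G 0 0 i' 0) = (\<Sum>k<N. \<Sum>i'<v1. x k 0 0 * x k i' 0)"
        unfolding G_def by (rule sum.swap)
      also have "\<dots> = (\<Sum>k<N. x k 0 0 * k2)"
        by (simp add: sum_distrib_left[symmetric] col pos)
      finally show ?thesis by (simp add: sum_distrib_right[symmetric] deg)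
    qed
    have t: "(\<Sum>i'<v1. \<Sum>j'<v2. G 0 0 i' j') = v1 * k1 * \<mu>"
    proof -
      have "(\<Sum>j'<v2. G 0 0 i' j') = k1 * \<mu>" if "i' < v1" for i'
      proof -
        have "(\<Sum>j'<v2. G 0 0 i' j') = (\<Sum>k<N. \<Sum>j'<v2. x k 0 0 * x k i' j')"
          unfolding G_def by (rule sum.swap)
        also have "\<dots> = (\<Sum>k<N. x k 0 0 * k1)"
          by (simp add: sum_distrib_left[symmetric] row that)
        finally show ?thesis by (simp add: sum_distrib_right[symmetric] deg)
      qed
      then show ?thesis by simp
    qed
    \<comment> \<open>The same three sums, now evaluated from the coefficients of \<open>G\<close>;
      \<open>M\<close> is the diagonal entry.\<close>
    have R: "real k1 * \<mu> = a + b * v2 + c + l22 * v2"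
      using r pos
      by (simp add: G sum.distrib e0 sum_distrib_left[symmetric] e_def[of 0 0] mult.commute)
    have S: "real k2 * \<mu> = a + b + c * v1 + l22 * v1"
      using s pos
      by (simp add: G sum.distrib e0 sum_distrib_left[symmetric] e_def[of 0 0] mult.commute)
    have T: "real v1 * real k1 * \<mu> = a + b * v2 + c * v1 + l22 * v1 * v2"
      using t Gu[OF pos, of "\<lambda>_ _. 1"] by (simp add: algebra_simps)
    have M: "a + b + c + l22 = \<mu>" by (simp add: a_def b_def c_def)
    have kk': "real v1 * real k1 = real v2 * real k2" using kk by (metis of_nat_mult)
    \<comment> \<open>The combination of \<open>M\<close>, \<open>S\<close>, \<open>R\<close> and
      \<open>T\<close> in which \<open>b\<close>, \<open>c\<close> and \<open>l22\<close>
      cancel.\<close>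
    have "(real v1 - 1) * (real v2 - 1) * a =
        real v1 * real v2 * (a + b + c + l22) - real v2 * (a + b + c * v1 + l22 * v1)
        - real v1 * (a + b * v2 + c + l22 * v2) + (a + b * v2 + c * v1 + l22 * v1 * v2)"
      by (simp add: algebra_simps)
    also have "\<dots> = real v1 * real v2 * \<mu> - (real v2 * real k2) * \<mu>"
      unfolding M R[symmetric] S[symmetric] T[symmetric] by simp
    finally have "(real v1 - 1) * (real v2 - 1) * a = real v1 * (real v2 - real k1) * \<mu>"
      unfolding kk'[symmetric] by (simp add: algebra_simps)
    moreover have "real ((v1 - 1) * (v2 - 1)) = (real v1 - 1) * (real v2 - 1)"
      using pos by (simp add: of_nat_diff)
    ultimately show "real ((v1 - 1) * (v2 - 1)) * a = real v1 * (real v2 - real k1) * real \<mu>"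
      by (simp only:)
  next
    fix u \<alpha> s
    assume es: "contrast_eigensystem v1 v2 (design_matrix v1 v2 N B) u \<alpha>"
      and sn: "s < (v1 - 1) * (v2 - 1)"
    define f where "f i j = u s $ (i * v2 + j)" for i j
    have ev: "eigenvector (transpose_mat X * X) (u s) (\<alpha> s)" and unit: "u s \<bullet> u s = 1"
      using es sn by (simp_all add: contrast_eigensystem_def X_def)
    have "u s \<in> admissible v1 v2"
      using contrast_eigensystem_admissible[OF es[folded X_def] Xc sn] .
    then have uc: "u s \<in> carrier_vec (v1 * v2)" and
      rows: "\<And>i. i < v1 \<Longrightarrow> (\<Sum>j<v2. f i j) = 0" and cols: "\<And>j. j < v2 \<Longrightarrow> (\<Sum>i<v1. f i j) = 0"
      by (auto simp: admissible_def f_def)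
    have eq: "\<alpha> s * f i j = a * f i j" if i: "i < v1" "j < v2" for i j
    proof -
      have "\<alpha> s * f i j = (\<Sum>k<N. x k i j * (\<Sum>i'<v1. \<Sum>j'<v2. x k i' j' * f i' j'))"
        using gram_eigenvector_entry[OF ev Xc lex_index_less[OF i]] i
        by (simp add: sum_lex Xx f_def)
      also have "\<dots> = (\<Sum>k<N. \<Sum>i'<v1. \<Sum>j'<v2. x k i j * x k i' j' * f i' j')"
        by (simp add: sum_distrib_left mult_ac)
      also have "\<dots> = (\<Sum>i'<v1. \<Sum>k<N. \<Sum>j'<v2. x k i j * x k i' j' * f i' j')"
        by (rule sum.swap)
      also have "\<dots> = (\<Sum>i'<v1. \<Sum>j'<v2. \<Sum>k<N. x k i j * x k i' j' * f i' j')"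
        by (intro sum.cong refl sum.swap)
      also have "\<dots> = (\<Sum>i'<v1. \<Sum>j'<v2. G i j i' j' * f i' j')"
        by (simp add: G_def sum_distrib_right)
      also have "\<dots> = a * f i j" using Gu[OF i] rows cols i by simp
      finally show ?thesis .
    qed
    \<comment> \<open>By \<open>eq\<close> a different eigenvalue would force every entry of the
      unit vector \<open>u s\<close> to be 0.\<close>
    show "\<alpha> s = a"
    proof (rule ccontr)
      assume "\<alpha> s \<noteq> a"
      then have "f i j = 0" if "i < v1" "j < v2" for i j using eq[OF that] by simp
      then have "u s \<bullet> u s = 0" using uc
        by (simp add: scalar_prod_lessThan sum_lex f_def)
      then show False using unit by simp
    qed
  qed
qed

section \<open>Convexity of the reciprocal and optimality\<close>

text \<open>The right-hand side is the tangent to 1/\<open>t\<close> at \<open>t = a\<close>; the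
  gap between curve and tangent is an explicit square over a positive denominator.\<close>

lemma inverse_tangent_bound:
  fixes a t :: real
  assumes "a > 0" "t > 0"
  shows "1 / t \<ge> 2 / a - t / a\<^sup>2"
proof -
  have "1 / t - (2 / a - t / a\<^sup>2) = (t - a)\<^sup>2 / (t * a\<^sup>2)"
    using assms by (simp add: field_simps power2_eq_square)
  moreover have "\<dots> \<ge> 0" using assms by simp
  ultimately show ?thesis by linarith
qed

theorem theorem3p8:
  fixes v1 v2 N k1 k2 \<mu> :: nat and B :: "nat \<Rightarrow> (nat \<times> nat) set"
  assumes "v1 > 0" and "v2 > 0" and "N > 0"
    and "N \<ge> (v1 - 1) * (v2 - 1)"
    and "v1 * k1 = v2 * k2"
    and "semi_regular_SBBD v1 v2 N k1 k2 \<mu> B"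
  shows "A_optimum v1 v2 N k1 k2 \<mu> (design_matrix v1 v2 N B)"
  unfolding A_optimum_def
proof (intro conjI ballI allI impI)
  define n where "n = (v1 - 1) * (v2 - 1)"
  show X: "design_matrix v1 v2 N B \<in> Omega v1 v2 N k1 k2 \<mu>"
    using assms(6) by (simp add: semi_regular_SBBD_def)
  fix X' u \<alpha> u' \<alpha>'
  assume X': "X' \<in> Omega v1 v2 N k1 k2 \<mu>"
    and es: "contrast_eigensystem v1 v2 (design_matrix v1 v2 N B) u \<alpha>"
    and es': "contrast_eigensystem v1 v2 X' u' \<alpha>'"
  show "(\<Sum>i<(v1 - 1) * (v2 - 1). 1 / \<alpha> i) \<le> (\<Sum>i<(v1 - 1) * (v2 - 1). 1 / \<alpha>' i)"
  \<comment> \<open>If one side is a single point, both sums are empty; otherwise index 0 exists and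
    shows that \<open>a\<close> is positive.\<close>
  proof (cases "n = 0")
    case True
    then show ?thesis unfolding n_def[symmetric] by simp
  next
    case False
    then have n0: "(v1 - 1) * (v2 - 1) > 0" by (simp add: n_def)
    obtain a where na: "real n * a = real v1 * (real v2 - real k1) * real \<mu>"
      and alpha: "\<And>s. s < n \<Longrightarrow> \<alpha> s = a"
      using SBBD_eigenvalues[OF assms(6,5) n0] es unfolding n_def by metis
    have a: "a > 0" using contrast_eigenvalue_pos[OF X es n0] alpha n0 by (simp add: n_def)
    have "(\<Sum>i<n. \<alpha>' i) \<le> n * a"
      using sum_contrast_eigenvalues_le[OF X' es' assms(1,2)] na by (simp add: n_def)
    then have "(\<Sum>i<n. \<alpha>' i) / a\<^sup>2 \<le> n * a / a\<^sup>2" by (rule divide_right_mono) simp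
    also have "\<dots> = 2 * (n / a) - n / a" using a by (simp add: field_simps power2_eq_square)
    \<comment> \<open>The left-hand side is the criterion for the SBBD, and the right-hand side is
      the sum of the tangents at \<open>a\<close> evaluated at the competing eigenvalues.\<close>
    finally have "n / a \<le> 2 * (n / a) - (\<Sum>i<n. \<alpha>' i) / a\<^sup>2" by linarith
    also have "\<dots> = (\<Sum>i<n. 2 / a - \<alpha>' i / a\<^sup>2)"
      by (simp add: sum_subtractf sum_divide_distrib)
    also have "\<dots> \<le> (\<Sum>i<n. 1 / \<alpha>' i)"
      by (intro sum_mono inverse_tangent_bound a contrast_eigenvalue_pos[OF X' es'])
        (simp add: n_def)
    finally show ?thesis using alpha by (simp add: n_def)
  qed
qed

end
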